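(* Let $\mathcal{H}$ be a complex separable Hilbert space and let $\mathcal{M},\mathcal{N}$ be (not necessarily closed) linear subspaces of $\mathcal{H}$ such that $\mathcal{M}\subseteq\mathcal{N}\oplus\mathcal{N}^{\perp}$. Then, as linear relations on $\mathcal{H}$, $$P_{\mathcal{M},\mathcal{N}}=P_{\mathcal{M}}\bigl((I-P_{\mathcal{N}})P_{\mathcal{M}}\bigr)^{-1}(I-P_{\mathcal{N}}).$$
   Context: A linear relation on $\mathcal{H}$ is a linear subspace of $\mathcal{H}\times\mathcal{H}$; operators (possibly not everywhere defined) are identified with their graphs. $T^{-1}=\{(y,x):(x,y)\in T\}$, $RT=\{(x,y):(x,z)\in T,(z,y)\in R\text{ for some }z\}$, $T+S=\{(x,y+z):(x,y)\in T,(x,z)\in S\}$. For subspaces $\mathcal{M},\mathcal{N}$ of $\mathcal{H}$, $P_{\mathcal{M},\mathcal{N}}=\{(m+n,m):m\in\mathcal{M},n\in\mathcal{N}\}$. $P_{\mathcal{M}}:=P_{\mathcal{M},\mathcal{M}^{\perp}}$ is the operator with domain $\mathcal{M}\oplus\mathcal{M}^{\perp}$ given by $m+m'\mapsto m$, and similarly for $P_{\mathcal{N}}$; $I-P_{\mathcal{N}}$ has domain $\mathcal{N}\oplus\mathcal{N}^\perp$. *)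

theory Defs
  imports "HOL-Analysis.Analysis"
begin

(* The inner product is linear in the first argument and conjugate linear in the second.
   Norm, metric and topology are those of real_normed_vector; the last axiom forces them to be
   the ones induced by the inner product, and the first one makes scaleR the restriction of
   the complex scalar multiplication to the reals. *)
class complex_inner = real_normed_vector +
  fixes scaleC :: "complex \<Rightarrow> 'a \<Rightarrow> 'a"  (infixr "*\<^sub>C" 75)
    and cinner :: "'a \<Rightarrow> 'a \<Rightarrow> complex"
  assumes scaleC_of_real: "complex_of_real r *\<^sub>C x = r *\<^sub>R x"
    and scaleC_add_right: "a *\<^sub>C (x + y) = a *\<^sub>C x + a *\<^sub>C y"
    and scaleC_add_left: "(a + b) *\<^sub>C x = a *\<^sub>C x + b *\<^sub>C x"
    and scaleC_scaleC: "a *\<^sub>C b *\<^sub>C x = (a * b) *\<^sub>C x"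
    and cinner_commute: "cinner x y = cnj (cinner y x)"
    and cinner_add_left: "cinner (x + y) z = cinner x z + cinner y z"
    and cinner_scaleC_left: "cinner (a *\<^sub>C x) y = a * cinner x y"
    and cinner_self_nonneg: "0 \<le> Re (cinner x x)"
    and cinner_self_eq_zero: "cinner x x = 0 \<longleftrightarrow> x = 0"
    and norm_eq_sqrt_cinner: "norm x = sqrt (Re (cinner x x))"

class complex_hilbert_space = complex_inner + complete_space

lemma scaleC_one: "1 *\<^sub>C x = (x :: 'a::complex_inner)"
  using scaleC_of_real[of 1 x] by simp

global_interpretation complex_vector: vector_space "scaleC :: complex \<Rightarrow> 'a \<Rightarrow> 'a::complex_inner"
  by standard (simp_all add: scaleC_add_right scaleC_add_left scaleC_scaleC scaleC_one)

abbreviation csubspace :: "'a::complex_inner set \<Rightarrow> bool"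
  where "csubspace \<equiv> complex_vector.subspace"

definition orth_compl :: "'a::complex_inner set \<Rightarrow> 'a set"
  where "orth_compl M = {x. \<forall>y\<in>M. cinner x y = 0}"

definition subspace_sum :: "'a::complex_inner set \<Rightarrow> 'a set \<Rightarrow> 'a set"
  where "subspace_sum M N = {m + n | m n. m \<in> M \<and> n \<in> N}"

(* Linear relations are sets of pairs; T\<inverse> is the library converse, and the identity
   operator is Id. The product R T applies T first: it is T O R in library notation. *)
definition rel_prod :: "('a \<times> 'a) set \<Rightarrow> ('a \<times> 'a) set \<Rightarrow> ('a \<times> 'a) set"  (infixr "\<cdot>\<^sub>r" 75)
  where "R \<cdot>\<^sub>r T = {(x, y). \<exists>z. (x, z) \<in> T \<and> (z, y) \<in> R}"

definition rel_add :: "('a::plus \<times> 'a) set \<Rightarrow> ('a \<times> 'a) set \<Rightarrow> ('a \<times> 'a) set"  (infixl "+\<^sub>r" 65)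
  where "T +\<^sub>r S = {(x, y + z) | x y z. (x, y) \<in> T \<and> (x, z) \<in> S}"

definition rel_neg :: "('a::uminus \<times> 'a) set \<Rightarrow> ('a \<times> 'a) set"
  where "rel_neg T = {(x, - y) | x y. (x, y) \<in> T}"

abbreviation rel_diff :: "('a::{plus,uminus} \<times> 'a) set \<Rightarrow> ('a \<times> 'a) set \<Rightarrow> ('a \<times> 'a) set"
    (infixl "-\<^sub>r" 65)
  where "T -\<^sub>r S \<equiv> T +\<^sub>r rel_neg S"

definition proj_rel :: "'a::complex_inner set \<Rightarrow> 'a set \<Rightarrow> ('a \<times> 'a) set"
  where "proj_rel M N = {(m + n, m) | m n. m \<in> M \<and> n \<in> N}"

definition orth_proj :: "'a::complex_inner set \<Rightarrow> ('a \<times> 'a) set"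
  where "orth_proj M = proj_rel M (orth_compl M)"

end

theory Submission
  imports Defs
begin

text \<open>A pair \<open>(x, y)\<close> lies in \<open>proj_rel M N\<close> iff
  \<open>y \<in> M\<close> and \<open>x - y \<in> N\<close> (\<open>proj_rel_iff\<close>). The
  relation I - P_N is the projection onto the complement of \<open>N\<close> along \<open>N\<close>
  (\<open>Id_diff_proj_rel\<close>), so two vectors with a common image under it differ by an
  element of \<open>N\<close>. On the right-hand side, the inverse followed by P_M sends
  \<open>p\<close> to values P_M w with (I - P_N) P_M w = p; as P_M is single-valued
  (\<open>orth_proj_unique\<close>), the output \<open>y\<close> is a vector of \<open>M\<close>
  with the same image \<open>p\<close> as \<open>x\<close>, whence \<open>x - y \<in> N\<close>.
  Conversely, the inclusion of \<open>M\<close> in the domain of P_N provides such a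
  \<open>p\<close> for every \<open>y \<in> M\<close>.\<close>

lemma subspace_orth_compl:
  fixes M :: "'a::complex_inner set"
  shows "csubspace (orth_compl M)"
proof (rule complex_vector.subspaceI)
  show "0 \<in> orth_compl M"
    using cinner_scaleC_left[of 0 "0 :: 'a"] by (simp add: orth_compl_def)
qed (simp_all add: orth_compl_def cinner_add_left cinner_scaleC_left)

lemma Int_orth_compl_eq_zero:
  assumes "x \<in> M" and "x \<in> orth_compl M"
  shows "x = 0"
  using assms cinner_self_eq_zero by (auto simp: orth_compl_def)

text \<open>The second summand is forced to be \<open>x - y\<close>, so no existential decomposition
  remains.\<close>

lemma proj_rel_iff: "(x, y) \<in> proj_rel M N \<longleftrightarrow> y \<in> M \<and> x - y \<in> N"
proof
  assume "y \<in> M \<and> x - y \<in> N"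
  moreover have "x = y + (x - y)" by simp
  ultimately show "(x, y) \<in> proj_rel M N"
    unfolding proj_rel_def by blast
qed (auto simp: proj_rel_def)

text \<open>Replacing \<open>y\<close> by \<open>x - y\<close> exchanges the two conditions in
  \<open>proj_rel_iff\<close>; this works for arbitrary sets.\<close>

lemma Id_diff_proj_rel: "Id -\<^sub>r proj_rel M N = proj_rel N M"
proof -
  have "(x, y) \<in> Id -\<^sub>r proj_rel M N \<longleftrightarrow> (x, x - y) \<in> proj_rel M N" for x y
  proof -
    have "(x, y) \<in> Id -\<^sub>r proj_rel M N \<longleftrightarrow> (\<exists>z. y = x - z \<and> (x, z) \<in> proj_rel M N)"
      by (auto simp: rel_add_def rel_neg_def)
    also have "\<dots> \<longleftrightarrow> (x, x - y) \<in> proj_rel M N"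
      by (metis diff_diff_eq2 add_diff_cancel_left')
    finally show ?thesis .
  qed
  then show ?thesis
    by (auto simp: proj_rel_iff)
qed

text \<open>The difference of two values lies in \<open>M\<close>, and as
  \<open>(x - z) - (x - y)\<close> also in its orthogonal complement.\<close>

lemma orth_proj_unique:
  assumes "csubspace M" and "(x, y) \<in> orth_proj M" and "(x, z) \<in> orth_proj M"
  shows "y = z"
proof -
  have "y - z \<in> M"
    using assms by (auto simp: orth_proj_def proj_rel_iff intro: complex_vector.subspace_diff)
  moreover have "(x - z) - (x - y) \<in> orth_compl M"
    by (rule complex_vector.subspace_diff[OF subspace_orth_compl])
      (use assms(2,3) in \<open>simp_all add: orth_proj_def proj_rel_iff\<close>)
  ultimately have "y - z = 0"
    by (intro Int_orth_compl_eq_zero) simp_all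
  then show ?thesis by simp
qed

theorem proposition3p4:
  fixes M N :: "'a::complex_hilbert_space set"
  assumes separable: "\<exists>D :: 'a set. countable D \<and> closure D = UNIV"
    and "csubspace M" and "csubspace N"
    and "M \<subseteq> subspace_sum N (orth_compl N)"
  shows "proj_rel M N
    = orth_proj M \<cdot>\<^sub>r ((Id -\<^sub>r orth_proj N) \<cdot>\<^sub>r orth_proj M)\<inverse> \<cdot>\<^sub>r (Id -\<^sub>r orth_proj N)"
    (is "_ = ?R")
proof -
  let ?Q = "proj_rel (orth_compl N) N"
  have Q: "Id -\<^sub>r orth_proj N = ?Q"
    by (simp add: orth_proj_def Id_diff_proj_rel)
  \<comment> \<open>The path runs from \<open>x\<close> to \<open>p\<close>, back through
    \<open>m\<close> to \<open>w\<close>, then on to \<open>y\<close>; both \<open>m\<close> and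
    \<open>y\<close> are images of \<open>w\<close> under P_M.\<close>
  have R: "(x, y) \<in> ?R \<longleftrightarrow>
      (\<exists>p w m. (x, p) \<in> ?Q \<and> (w, m) \<in> orth_proj M \<and> (m, p) \<in> ?Q \<and> (w, y) \<in> orth_proj M)" for x y
    unfolding Q rel_prod_def by blast
  have "(x, y) \<in> proj_rel M N \<longleftrightarrow> (x, y) \<in> ?R" for x y
  proof
    assume "(x, y) \<in> proj_rel M N"
    then have y: "y \<in> M" and xy: "x - y \<in> N"
      by (auto simp: proj_rel_iff)
    from y assms(4) obtain n p where np: "n \<in> N" "p \<in> orth_compl N" "y = n + p"
      unfolding subspace_sum_def by blast
    \<comment> \<open>This vector is \<open>x - p\<close>, so \<open>x\<close> has the same
      component \<open>p\<close> as \<open>y\<close>.\<close>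
    have "(x - y) + n \<in> N"
      using assms(3) xy np by (intro complex_vector.subspace_add)
    then have "(x, p) \<in> ?Q"
      using np by (simp add: proj_rel_iff)
    moreover have "(y, p) \<in> ?Q"
      using np by (simp add: proj_rel_iff)
    \<comment> \<open>P_M fixes \<open>M\<close>, so \<open>w\<close> and \<open>m\<close> can both
      be taken to be \<open>y\<close>.\<close>
    moreover have "(y, y) \<in> orth_proj M"
      using y complex_vector.subspace_0[OF subspace_orth_compl]
      by (simp add: orth_proj_def proj_rel_iff)
    ultimately show "(x, y) \<in> ?R"
      unfolding R by blast
  next
    assume "(x, y) \<in> ?R"
    then obtain p w m where p: "(x, p) \<in> ?Q" "(m, p) \<in> ?Q"
      and w: "(w, m) \<in> orth_proj M" "(w, y) \<in> orth_proj M"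
      unfolding R by blast
    have "m = y"
      using assms(2) w by (rule orth_proj_unique)
    \<comment> \<open>The common image \<open>p\<close> cancels, leaving \<open>x - m\<close>, which
      is \<open>x - y\<close>.\<close>
    have "(x - p) - (m - p) \<in> N"
      by (rule complex_vector.subspace_diff[OF assms(3)]) (use p in \<open>simp_all add: proj_rel_iff\<close>)
    then show "(x, y) \<in> proj_rel M N"
      using w \<open>m = y\<close> by (simp add: orth_proj_def proj_rel_iff)
  qed
  then show ?thesis by auto
qed

end
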